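(* There exists a complete locally convex topological vector space $X$ over $\mathbb{C}$ of countable algebraic dimension ($\dim X=\aleph_0$) which does not have the invariant subspace property; that is, there is a continuous linear operator $T:X\to X$ such that the only closed linear subspaces $M$ of $X$ with $T(M)\subseteq M$ are $\{0\}$ and $X$.
   Context: All vector spaces are over the field $\mathbb{C}$ of complex numbers and all topological spaces (in particular all topological vector spaces) are assumed to be Hausdorff. For a topological vector space $X$, $L(X)$ is the algebra of continuous linear operators on $X$. A topological vector space $X$ has the invariant subspace property if every $T\in L(X)$ has a non-trivial (that is, different from $\{0\}$ and $X$) closed invariant subspace. Algebraic dimension means the cardinality of a Hamel basis. *)

theory Defs
  imports "HOL-Analysis.Analysis" "HOL-Library.Function_Algebras" "HOL-Library.Equipollence"
begin

text \<open>
  The space is \<^term>\<open>topspace X\<close>, a linear subspace of the ambient complex vector space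
  given by the type and \<open>scale\<close>; its topology is \<open>X\<close>.  Hausdorffness is part
  of the notion of a topological vector space.
\<close>

locale complex_tvs = vector_space scale
  for scale :: "complex \<Rightarrow> 'a::ab_group_add \<Rightarrow> 'a" +
  fixes X :: "'a topology"
  assumes subspace_topspace: "subspace (topspace X)"
    and continuous_add: "continuous_map (prod_topology X X) X (\<lambda>(x, y). x + y)"
    and continuous_scale: "continuous_map (prod_topology euclidean X) X (\<lambda>(c, x). scale c x)"
    and Hausdorff: "Hausdorff_space X"
begin

definition convex_set :: "'a set \<Rightarrow> bool" where
  "convex_set C \<longleftrightarrow> (\<forall>x\<in>C. \<forall>y\<in>C. \<forall>t::real. 0 \<le> t \<and> t \<le> 1 \<longrightarrow>
     scale (complex_of_real (1 - t)) x + scale (complex_of_real t) y \<in> C)"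

definition locally_convex :: bool where
  "locally_convex \<longleftrightarrow> neighbourhood_base_at 0 convex_set X"

text \<open>Cauchy with respect to the translation-invariant uniformity of \<open>X\<close>.\<close>

definition cauchy_filter_on :: "'a filter \<Rightarrow> bool" where
  "cauchy_filter_on F \<longleftrightarrow> (\<forall>\<^sub>F x in F. x \<in> topspace X) \<and>
     (\<forall>U. openin X U \<and> 0 \<in> U \<longrightarrow> (\<forall>\<^sub>F (x, y) in F \<times>\<^sub>F F. x - y \<in> U))"

definition complete_tvs :: bool where
  "complete_tvs \<longleftrightarrow>
     (\<forall>F. F \<noteq> bot \<and> cauchy_filter_on F \<longrightarrow> (\<exists>l. limitin X (\<lambda>x. x) l F))"

definition countable_algebraic_dim :: bool where
  "countable_algebraic_dim \<longleftrightarrow>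
     (\<exists>B. independent B \<and> span B = topspace X \<and> B \<approx> (UNIV :: nat set))"

text \<open>Only the values of an operator on \<^term>\<open>topspace X\<close> matter.\<close>

definition continuous_linear_operator :: "('a \<Rightarrow> 'a) \<Rightarrow> bool" where
  "continuous_linear_operator T \<longleftrightarrow> continuous_map X X T \<and>
     (\<forall>x\<in>topspace X. \<forall>y\<in>topspace X. T (x + y) = T x + T y) \<and>
     (\<forall>c. \<forall>x\<in>topspace X. T (scale c x) = scale c (T x))"

definition closed_invariant_subspace :: "('a \<Rightarrow> 'a) \<Rightarrow> 'a set \<Rightarrow> bool" where
  "closed_invariant_subspace T M \<longleftrightarrow> subspace M \<and> closedin X M \<and> T ` M \<subseteq> M"

definition invariant_subspace_property :: bool where
  "invariant_subspace_property \<longleftrightarrow>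
     (\<forall>T. continuous_linear_operator T \<longrightarrow>
        (\<exists>M. closed_invariant_subspace T M \<and> M \<noteq> {0} \<and> M \<noteq> topspace X))"

end

end

theory Submission
  imports Defs "HOL-Computational_Algebra.Fundamental_Theorem_Algebra"
begin

text \<open>
  The space is the space of polynomials \<open>\<Sum> f n * x^n\<close>, represented by finitely supported coefficient
  sequences, and the operator is integration from 1, so that
  \<open>T (x^n) = (x^(n+1) - 1) / (n+1)\<close>.  The topology comes from the seminorms
  \<open>\<Sum> w n * \<bar>f n\<bar>\<close>, where \<open>w\<close> runs through the nonnegative weights with
  \<open>\<Sum> min 1 (w n) / (n+1) < \<infinity>\<close>.

  Two features of these weights pull in opposite directions.  A weight may be arbitrarily large along
  a sparse set of indices, and every infinite set of indices contains an infinite sparse subset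
  (\<open>weights_large_on_infinite\<close>); hence a Cauchy filter, which converges coefficientwise, has a limit
  with finite support, and the space is complete.  On the other hand the harmonic series diverges, so
  every weight is arbitrarily small infinitely often (\<open>weights_frequently_small\<close>); hence a linear
  functional whose values on the monomials stay away from 0 is discontinuous.

  The vector 1 is cyclic, so for a nonzero closed invariant subspace \<open>M\<close> the polynomials \<open>p\<close> with
  \<open>p(T) 1\<close> in \<open>M\<close> form a nonzero ideal, and the fundamental theorem of algebra reduces the claim
  \<open>M = X\<close> to the possibility of cancelling one factor \<open>T - c\<close>: if \<open>(T - c) r(T) 1\<close> is in \<open>M\<close>,
  then so is \<open>r(T) 1\<close>
  (\<open>closed_invariant_cancel_linear_factor\<close>).  The obstruction to cancelling would be a continuous
  functional \<open>\<phi>\<close> with \<open>\<phi> (T f) = c * \<phi> f\<close> and \<open>\<phi> 1 = 1\<close>.  There is just one such linear functional; its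
  values \<open>s n = \<phi> (x^n)\<close> satisfy \<open>s (n+1) = 1 + (n+1) * c * s n\<close>, whence
  \<open>s n = n! * c^n * (\<Sum>k\<le>n. c^(-k) / k!)\<close> for \<open>c \<noteq> 0\<close>.  The partial sums tend to \<open>exp (1/c)\<close>.  Because the
  exponential function has no zeros, \<open>\<bar>s n\<bar>\<close> eventually stays away from 0 for every \<open>c\<close>
  (\<open>poly_mono_poly_bounded_below\<close>), and no such functional is continuous.  Concretely,
  \<open>x^n - s n\<close> lies in the range of \<open>T - c\<close>, so \<open>1 - x^n / s n\<close> does too once \<open>s n \<noteq> 0\<close>, and in
  each seminorm \<open>x^n / s n\<close> comes arbitrarily close to 0 for suitable \<open>n\<close>.
\<close>

section \<open>Locally convex spaces given by seminorms\<close>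

text \<open>
  The seminorms live on the subspace \<open>S\<close> only, since the ambient type may be larger than the space.
  Directedness makes single seminorm balls, instead of finite intersections of them, a base.
\<close>

locale separating_seminorms = vector_space scale
  for scale :: "complex \<Rightarrow> 'a::ab_group_add \<Rightarrow> 'a" +
  fixes S :: "'a set" and I :: "'i set" and P :: "'i \<Rightarrow> 'a \<Rightarrow> real"
  assumes subspace_S: "subspace S"
    and I_nonempty: "I \<noteq> {}"
    and directed: "\<lbrakk>i \<in> I; j \<in> I\<rbrakk> \<Longrightarrow> \<exists>k\<in>I. \<forall>x\<in>S. P i x \<le> P k x \<and> P j x \<le> P k x"
    and P_add: "\<lbrakk>i \<in> I; x \<in> S; y \<in> S\<rbrakk> \<Longrightarrow> P i (x + y) \<le> P i x + P i y"
    and P_scale: "\<lbrakk>i \<in> I; x \<in> S\<rbrakk> \<Longrightarrow> P i (scale c x) = cmod c * P i x"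
    and separating: "\<lbrakk>x \<in> S; x \<noteq> 0\<rbrakk> \<Longrightarrow> \<exists>i\<in>I. P i x > 0"
begin

definition seminorm_topology :: "'a topology" where
  "seminorm_topology = topology (\<lambda>U. U \<subseteq> S \<and>
     (\<forall>x\<in>U. \<exists>i\<in>I. \<exists>e>0. \<forall>y\<in>S. P i (y - x) < e \<longrightarrow> y \<in> U))"

lemma openin_seminorm_topology:
  "openin seminorm_topology U \<longleftrightarrow>
     U \<subseteq> S \<and> (\<forall>x\<in>U. \<exists>i\<in>I. \<exists>e>0. \<forall>y\<in>S. P i (y - x) < e \<longrightarrow> y \<in> U)"
proof -
  define Q where "Q = (\<lambda>U. U \<subseteq> S \<and>
     (\<forall>x\<in>U. \<exists>i\<in>I. \<exists>e>0. \<forall>y\<in>S. P i (y - x) < e \<longrightarrow> y \<in> U))"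
  have "istopology Q"
    unfolding istopology_def
  proof (intro conjI allI impI)
    fix U V assume U: "Q U" and V: "Q V"
    have "\<exists>i\<in>I. \<exists>e>0. \<forall>y\<in>S. P i (y - x) < e \<longrightarrow> y \<in> U \<inter> V" if x: "x \<in> U \<inter> V" for x
    proof -
      obtain i d where i: "i \<in> I" "d > 0" "\<And>y. y \<in> S \<Longrightarrow> P i (y - x) < d \<Longrightarrow> y \<in> U"
        using U x unfolding Q_def by blast
      obtain j e where j: "j \<in> I" "e > 0" "\<And>y. y \<in> S \<Longrightarrow> P j (y - x) < e \<Longrightarrow> y \<in> V"
        using V x unfolding Q_def by blast
      obtain k where k: "k \<in> I" "\<And>x. x \<in> S \<Longrightarrow> P i x \<le> P k x \<and> P j x \<le> P k x"
        using directed i(1) j(1) by blast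
      have xS: "x \<in> S" using U x unfolding Q_def by blast
      show ?thesis
      proof (intro bexI[OF _ k(1)] exI[of _ "min d e"] conjI ballI impI)
        show "min d e > 0" using i j by simp
      next
        fix y assume y: "y \<in> S" "P k (y - x) < min d e"
        have "P i (y - x) \<le> P k (y - x) \<and> P j (y - x) \<le> P k (y - x)"
          using k(2) subspace_diff[OF subspace_S y(1) xS] by blast
        then show "y \<in> U \<inter> V" using i(3) j(3) y by auto
      qed
    qed
    then show "Q (U \<inter> V)" using U V unfolding Q_def by blast
  next
    fix \<U> assume "\<forall>U\<in>\<U>. Q U"
    then show "Q (\<Union>\<U>)" unfolding Q_def by (meson UnionE UnionI Union_least)
  qed
  then show ?thesis
    unfolding seminorm_topology_def Q_def[symmetric]
    by (simp add: topology_inverse' Q_def)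
qed

lemma topspace_seminorm_topology [simp]: "topspace seminorm_topology = S"
proof
  show "topspace seminorm_topology \<subseteq> S"
    using openin_seminorm_topology openin_topspace by blast
  have "openin seminorm_topology S"
    unfolding openin_seminorm_topology using I_nonempty zero_less_one by blast
  then show "S \<subseteq> topspace seminorm_topology"
    by (rule openin_subset)
qed

lemma P_zero: "i \<in> I \<Longrightarrow> P i 0 = 0"
  using P_scale[of i 0 0] subspace_0[OF subspace_S] by simp

lemma P_uminus: "i \<in> I \<Longrightarrow> x \<in> S \<Longrightarrow> P i (- x) = P i x"
  using P_scale[of i x "-1"] by simp

lemma P_nonneg: "i \<in> I \<Longrightarrow> x \<in> S \<Longrightarrow> P i x \<ge> 0"
  using P_add[of i x "- x"] P_uminus[of i x] P_zero[of i] subspace_neg[OF subspace_S]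
  by fastforce

lemma P_diff_triangle:
  assumes "i \<in> I" "x \<in> S" "y \<in> S" "z \<in> S"
  shows "P i (x - z) \<le> P i (x - y) + P i (y - z)"
  using P_add[of i "x - y" "y - z"] assms subspace_diff[OF subspace_S] by simp

lemma P_diff_commute: "\<lbrakk>i \<in> I; x \<in> S; y \<in> S\<rbrakk> \<Longrightarrow> P i (x - y) = P i (y - x)"
  using P_uminus[of i "x - y"] subspace_diff[OF subspace_S] by simp

lemma openin_seminorm_ball:
  assumes i: "i \<in> I" and x: "x \<in> S"
  shows "openin seminorm_topology {y \<in> S. P i (y - x) < e}"
  unfolding openin_seminorm_topology
proof (intro conjI ballI)
  fix y assume y: "y \<in> {y \<in> S. P i (y - x) < e}"
  have "z \<in> {y \<in> S. P i (y - x) < e}" if "z \<in> S" "P i (z - y) < e - P i (y - x)" for z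
    using P_diff_triangle[of i z y x] i x y that by auto
  then show "\<exists>j\<in>I. \<exists>d>0. \<forall>z\<in>S. P j (z - y) < d \<longrightarrow> z \<in> {y \<in> S. P i (y - x) < e}"
    using y by (intro bexI[OF _ i] exI[of _ "e - P i (y - x)"]) auto
qed auto

lemma seminorm_ball_contains_centre:
  "\<lbrakk>i \<in> I; x \<in> S; e > 0\<rbrakk> \<Longrightarrow> x \<in> {y \<in> S. P i (y - x) < e}"
  by (simp add: P_zero)

lemma continuous_add_seminorm:
  "continuous_map (prod_topology seminorm_topology seminorm_topology) seminorm_topology
     (\<lambda>(x, y). x + y)"
  unfolding continuous_map_def
proof (intro conjI allI impI)
  show "(\<lambda>(x, y). x + y) \<in>
      topspace (prod_topology seminorm_topology seminorm_topology) \<rightarrow> topspace seminorm_topology"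
    using subspace_add[OF subspace_S] by auto
next
  fix U assume U: "openin seminorm_topology U"
  show "openin (prod_topology seminorm_topology seminorm_topology)
      {z \<in> topspace (prod_topology seminorm_topology seminorm_topology). (case z of (x, y) \<Rightarrow> x + y) \<in> U}"
    unfolding openin_prod_topology_alt
  proof (intro allI impI)
    fix x y assume "(x, y) \<in> {z \<in> topspace (prod_topology seminorm_topology seminorm_topology).
      (case z of (x, y) \<Rightarrow> x + y) \<in> U}"
    then have xy: "x \<in> S" "y \<in> S" "x + y \<in> U" by auto
    then obtain i e where ie: "i \<in> I" "e > 0" "\<And>z. z \<in> S \<Longrightarrow> P i (z - (x + y)) < e \<Longrightarrow> z \<in> U"
      using U unfolding openin_seminorm_topology by blast
    have "x' + y' \<in> U" if x': "x' \<in> S" "P i (x' - x) < e/2" and y': "y' \<in> S" "P i (y' - y) < e/2" for x' y'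
    proof (rule ie(3))
      show "x' + y' \<in> S" using subspace_add[OF subspace_S] x' y' by blast
      have "P i ((x' - x) + (y' - y)) \<le> P i (x' - x) + P i (y' - y)"
        by (intro P_add subspace_diff[OF subspace_S]) fact+
      moreover have "x' + y' - (x + y) = (x' - x) + (y' - y)" by simp
      ultimately have "P i (x' + y' - (x + y)) \<le> P i (x' - x) + P i (y' - y)" by (simp only:)
      then show "P i (x' + y' - (x + y)) < e"
        using x' y' by linarith
    qed
    then have sub: "{z \<in> S. P i (z - x) < e/2} \<times> {z \<in> S. P i (z - y) < e/2} \<subseteq>
        {z \<in> topspace (prod_topology seminorm_topology seminorm_topology). (case z of (x, y) \<Rightarrow> x + y) \<in> U}"
      by auto
    show "\<exists>A B. openin seminorm_topology A \<and> openin seminorm_topology B \<and> x \<in> A \<and> y \<in> B \<and>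
      A \<times> B \<subseteq> {z \<in> topspace (prod_topology seminorm_topology seminorm_topology). (case z of (x, y) \<Rightarrow> x + y) \<in> U}"
    proof (intro exI conjI)
      show "openin seminorm_topology {z \<in> S. P i (z - x) < e/2}"
        "openin seminorm_topology {z \<in> S. P i (z - y) < e/2}"
        by (rule openin_seminorm_ball, fact, fact)+
      show "x \<in> {z \<in> S. P i (z - x) < e/2}" "y \<in> {z \<in> S. P i (z - y) < e/2}"
        by (rule seminorm_ball_contains_centre, fact, fact, use ie in simp)+
    qed (rule sub)
  qed
qed

lemma continuous_scale_seminorm:
  "continuous_map (prod_topology euclidean seminorm_topology) seminorm_topology
     (\<lambda>(c, x). scale c x)"
  unfolding continuous_map_def
proof (intro conjI allI impI)
  show "(\<lambda>(c, x). scale c x) \<in>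
      topspace (prod_topology euclidean seminorm_topology) \<rightarrow> topspace seminorm_topology"
    using subspace_scale[OF subspace_S] by auto
next
  fix U assume U: "openin seminorm_topology U"
  show "openin (prod_topology euclidean seminorm_topology)
      {z \<in> topspace (prod_topology euclidean seminorm_topology). (case z of (c, x) \<Rightarrow> scale c x) \<in> U}"
    unfolding openin_prod_topology_alt
  proof (intro allI impI)
    fix c x assume "(c, x) \<in> {z \<in> topspace (prod_topology euclidean seminorm_topology).
      (case z of (c, x) \<Rightarrow> scale c x) \<in> U}"
    then have cx: "x \<in> S" "scale c x \<in> U" by auto
    then obtain i e where ie: "i \<in> I" "e > 0" "\<And>z. z \<in> S \<Longrightarrow> P i (z - scale c x) < e \<Longrightarrow> z \<in> U"
      using U unfolding openin_seminorm_topology by blast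
    have Px: "P i x \<ge> 0" using P_nonneg ie cx by blast
    define a where "a = min 1 (e / (2 * (P i x + 1)))"
    define b where "b = e / (2 * (cmod c + 1))"
    have a: "a > 0" "a \<le> 1" and b: "b > 0"
      using ie Px by (auto simp: a_def b_def add_nonneg_pos)
    have "scale d y \<in> U" if d: "dist d c < a" and y: "y \<in> S" "P i (y - x) < b" for d y
    proof (rule ie(3))
      show "scale d y \<in> S" using subspace_scale[OF subspace_S] y by blast
      have yx: "y - x \<in> S" using subspace_diff[OF subspace_S] y cx by blast
      have "scale d y - scale c x = scale d (y - x) + scale (d - c) x"
        by (simp add: algebra_simps)
      then have "P i (scale d y - scale c x) \<le> P i (scale d (y - x)) + P i (scale (d - c) x)"
        using P_add ie yx cx subspace_scale[OF subspace_S] by presburger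
      also have "\<dots> = cmod d * P i (y - x) + cmod (d - c) * P i x"
        using P_scale ie yx cx by presburger
      also have "\<dots> < e"
      proof -
        have dc: "cmod (d - c) < a" using d by (simp add: dist_norm)
        have "cmod d \<le> cmod c + cmod (d - c)"
          by (metis add.commute diff_add_cancel norm_triangle_ineq)
        then have "cmod d \<le> cmod c + 1" using dc a by linarith
        then have "cmod d * P i (y - x) \<le> (cmod c + 1) * P i (y - x)"
          using P_nonneg[OF ie(1) yx] by (intro mult_right_mono) auto
        also have "\<dots> < (cmod c + 1) * b"
          using y by (intro mult_strict_left_mono) (auto simp: add_nonneg_pos)
        also have "\<dots> = e / 2"
        proof -
          have "cmod c + 1 \<noteq> 0" using norm_ge_zero[of c] by linarith
          moreover have "N * (e / (2 * N)) = e / 2" if "N \<noteq> 0" for N using that by simp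
          ultimately show ?thesis unfolding b_def by blast
        qed
        finally have 1: "cmod d * P i (y - x) < e / 2" .
        have "cmod (d - c) * P i x \<le> a * P i x"
          using dc Px by (intro mult_right_mono) auto
        also have "\<dots> \<le> e / (2 * (P i x + 1)) * (P i x + 1)"
          using a Px by (intro mult_mono) (auto simp: a_def)
        also have "\<dots> = e / 2" using Px by (simp add: field_simps)
        finally show ?thesis using 1 by linarith
      qed
      finally show "P i (scale d y - scale c x) < e" .
    qed
    then have sub: "ball c a \<times> {z \<in> S. P i (z - x) < b} \<subseteq>
        {z \<in> topspace (prod_topology euclidean seminorm_topology). (case z of (c, x) \<Rightarrow> scale c x) \<in> U}"
      by (auto simp: dist_commute)
    show "\<exists>A B. openin euclidean A \<and> openin seminorm_topology B \<and> c \<in> A \<and> x \<in> B \<and>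
      A \<times> B \<subseteq> {z \<in> topspace (prod_topology euclidean seminorm_topology). (case z of (c, x) \<Rightarrow> scale c x) \<in> U}"
    proof (intro exI conjI)
      show "openin euclidean (ball c a)" "c \<in> ball c a" using a by auto
      show "openin seminorm_topology {z \<in> S. P i (z - x) < b}"
        by (rule openin_seminorm_ball) fact+
      show "x \<in> {z \<in> S. P i (z - x) < b}"
        by (rule seminorm_ball_contains_centre) fact+
    qed (rule sub)
  qed
qed

lemma Hausdorff_seminorm: "Hausdorff_space seminorm_topology"
  unfolding Hausdorff_space_def
proof (intro allI impI)
  fix x y assume "x \<in> topspace seminorm_topology \<and> y \<in> topspace seminorm_topology \<and> x \<noteq> y"
  then have xy: "x \<in> S" "y \<in> S" "x \<noteq> y" by auto
  then obtain i where i: "i \<in> I" "P i (x - y) > 0"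
    using separating[of "x - y"] subspace_diff[OF subspace_S] by auto
  define e where "e = P i (x - y) / 2"
  have "e > 0" using i by (simp add: e_def)
  moreover have "disjnt {z \<in> S. P i (z - x) < e} {z \<in> S. P i (z - y) < e}"
  proof -
    have "P i (x - y) \<le> P i (z - x) + P i (z - y)" if "z \<in> S" for z
      using P_diff_triangle[of i x z y] P_diff_commute[of i x z] i xy that by simp
    then show ?thesis unfolding disjnt_def e_def by fastforce
  qed
  ultimately show "\<exists>U V. openin seminorm_topology U \<and> openin seminorm_topology V \<and>
      x \<in> U \<and> y \<in> V \<and> disjnt U V"
    using openin_seminorm_ball seminorm_ball_contains_centre i xy by meson
qed

sublocale complex_tvs scale seminorm_topology
  by unfold_locales
    (simp_all add: subspace_S continuous_add_seminorm continuous_scale_seminorm Hausdorff_seminorm)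

lemma convex_seminorm_ball:
  assumes i: "i \<in> I"
  shows "convex_set {y \<in> S. P i (y - 0) < e}"
  unfolding convex_set_def
proof (intro ballI allI impI)
  fix x y and t :: real
  assume x: "x \<in> {y \<in> S. P i (y - 0) < e}" and y: "y \<in> {y \<in> S. P i (y - 0) < e}" and t: "0 \<le> t \<and> t \<le> 1"
  let ?a = "scale (complex_of_real (1 - t)) x" and ?b = "scale (complex_of_real t) y"
  have S: "?a \<in> S" "?b \<in> S" using x y subspace_scale[OF subspace_S] by blast+
  have "P i (?a + ?b) \<le> P i ?a + P i ?b" using P_add[OF i S] .
  also have "\<dots> = (1 - t) * P i x + t * P i y"
    using P_scale[OF i] x y t by (simp del: of_real_diff)
  also have "\<dots> < e"
    using convex_bound_lt[of "P i x" e "P i y" "1 - t" t] x y t by auto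
  finally show "?a + ?b \<in> {y \<in> S. P i (y - 0) < e}"
    using subspace_add[OF subspace_S S] by simp
qed

lemma locally_convex_seminorm: "locally_convex"
  unfolding locally_convex_def neighbourhood_base_at_def
proof (intro allI impI)
  fix W assume "openin seminorm_topology W \<and> 0 \<in> W"
  then obtain i e where "i \<in> I" "e > 0" and sub: "\<And>y. y \<in> S \<Longrightarrow> P i (y - 0) < e \<Longrightarrow> y \<in> W"
    unfolding openin_seminorm_topology by blast
  then show "\<exists>U V. openin seminorm_topology U \<and> convex_set V \<and> 0 \<in> U \<and> U \<subseteq> V \<and> V \<subseteq> W"
    using openin_seminorm_ball[of i 0 e] convex_seminorm_ball[of i e]
      seminorm_ball_contains_centre[of i 0 e] subspace_0[OF subspace_S]
    by (intro exI[of _ "{y \<in> S. P i (y - 0) < e}"]) auto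
qed

lemma continuous_map_seminormI:
  assumes T_S: "\<And>x. x \<in> S \<Longrightarrow> T x \<in> S"
    and T_diff: "\<And>x y. \<lbrakk>x \<in> S; y \<in> S\<rbrakk> \<Longrightarrow> T (x - y) = T x - T y"
    and bound: "\<And>i. i \<in> I \<Longrightarrow> \<exists>j\<in>I. \<forall>x\<in>S. P i (T x) \<le> P j x"
  shows "continuous_map seminorm_topology seminorm_topology T"
  unfolding continuous_map_def
proof (intro conjI allI impI)
  show "T \<in> topspace seminorm_topology \<rightarrow> topspace seminorm_topology" using T_S by auto
next
  fix U assume U: "openin seminorm_topology U"
  have "\<exists>i\<in>I. \<exists>e>0. \<forall>y\<in>S. P i (y - x) < e \<longrightarrow> y \<in> S \<and> T y \<in> U" if x: "x \<in> S" "T x \<in> U" for x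
  proof -
    obtain i e where ie: "i \<in> I" "e > 0" "\<And>z. z \<in> S \<Longrightarrow> P i (z - T x) < e \<Longrightarrow> z \<in> U"
      using U x unfolding openin_seminorm_topology by blast
    obtain j where j: "j \<in> I" "\<And>x. x \<in> S \<Longrightarrow> P i (T x) \<le> P j x" using bound ie by blast
    have "T y \<in> U" if "y \<in> S" "P j (y - x) < e" for y
      using ie(3)[OF T_S[OF that(1)]] j(2)[of "y - x"] T_diff[OF that(1) x(1)]
        subspace_diff[OF subspace_S that(1) x(1)] that(2) by simp
    then show ?thesis using j ie by blast
  qed
  then show "openin seminorm_topology {x \<in> topspace seminorm_topology. T x \<in> U}"
    unfolding openin_seminorm_topology by auto
qed

lemma closedin_seminormD:
  assumes M: "closedin seminorm_topology M" and x: "x \<in> S"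
    and approx: "\<And>i e. \<lbrakk>i \<in> I; e > 0\<rbrakk> \<Longrightarrow> \<exists>m\<in>M. P i (m - x) < e"
  shows "x \<in> M"
proof (rule ccontr)
  assume "x \<notin> M"
  then have "x \<in> S - M" using x by simp
  moreover have "openin seminorm_topology (S - M)"
    using M unfolding closedin_def by simp
  ultimately obtain i e where ie: "i \<in> I" "e > 0" "\<And>y. y \<in> S \<Longrightarrow> P i (y - x) < e \<Longrightarrow> y \<in> S - M"
    unfolding openin_seminorm_topology by blast
  obtain m where "m \<in> M" "P i (m - x) < e" using approx ie by blast
  moreover have "M \<subseteq> S" using closedin_subset[OF M] by simp
  ultimately show False using ie(3) by blast
qed

lemma cauchy_filter_on_seminormD:
  assumes F: "cauchy_filter_on F" and i: "i \<in> I" and e: "e > 0"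
  obtains Q where "eventually Q F" "\<And>x y. Q x \<Longrightarrow> Q y \<Longrightarrow> x \<in> S \<and> y \<in> S \<and> P i (x - y) < e"
proof -
  have "openin seminorm_topology {y \<in> S. P i (y - 0) < e} \<and> 0 \<in> {y \<in> S. P i (y - 0) < e}"
    using openin_seminorm_ball seminorm_ball_contains_centre i e subspace_0[OF subspace_S] by blast
  then have "\<forall>\<^sub>F (x, y) in F \<times>\<^sub>F F. x - y \<in> {y \<in> S. P i (y - 0) < e}"
    using F unfolding cauchy_filter_on_def by blast
  then obtain Q where Q: "eventually Q F" "\<And>x y. Q x \<Longrightarrow> Q y \<Longrightarrow> P i (x - y) < e"
    unfolding eventually_prod_same by auto
  have "\<forall>\<^sub>F x in F. x \<in> S" using F unfolding cauchy_filter_on_def by simp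
  then have "\<forall>\<^sub>F x in F. Q x \<and> x \<in> S" using Q(1) by (simp add: eventually_conj)
  then show thesis using that[of "\<lambda>x. Q x \<and> x \<in> S"] Q(2) by blast
qed

lemma limitin_seminormI:
  assumes l: "l \<in> S" and F: "\<forall>\<^sub>F x in F. x \<in> S"
    and conv: "\<And>i e. \<lbrakk>i \<in> I; e > 0\<rbrakk> \<Longrightarrow> \<forall>\<^sub>F x in F. P i (x - l) < e"
  shows "limitin seminorm_topology (\<lambda>x. x) l F"
  unfolding limitin_def
proof (intro conjI allI impI)
  fix U assume "openin seminorm_topology U \<and> l \<in> U"
  then obtain i e where ie: "i \<in> I" "e > 0" "\<And>y. y \<in> S \<Longrightarrow> P i (y - l) < e \<Longrightarrow> y \<in> U"
    unfolding openin_seminorm_topology by blast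
  show "\<forall>\<^sub>F x in F. x \<in> U"
    using conv[OF ie(1,2)] F by eventually_elim (use ie(3) in blast)
qed (use l in simp)

end

section \<open>Polynomials in an operator and cyclic vectors\<close>

locale subspace_endomorphism = vector_space scale
  for scale :: "'b::field \<Rightarrow> 'a::ab_group_add \<Rightarrow> 'a" +
  fixes S :: "'a set" and T :: "'a \<Rightarrow> 'a"
  assumes subspace_S: "subspace S"
    and T_in: "x \<in> S \<Longrightarrow> T x \<in> S"
    and T_add: "\<lbrakk>x \<in> S; y \<in> S\<rbrakk> \<Longrightarrow> T (x + y) = T x + T y"
    and T_scale: "x \<in> S \<Longrightarrow> T (scale c x) = scale c (T x)"
begin

definition poly_op :: "'b poly \<Rightarrow> 'a \<Rightarrow> 'a" where
  "poly_op p x = (\<Sum>i\<le>degree p. scale (coeff p i) ((T ^^ i) x))"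

lemma T_zero [simp]: "T 0 = 0"
  using T_scale[of 0 0] subspace_0[OF subspace_S] by simp

lemma T_diff: "\<lbrakk>x \<in> S; y \<in> S\<rbrakk> \<Longrightarrow> T (x - y) = T x - T y"
  using T_add[of "x - y" y] subspace_diff[OF subspace_S] by (simp add: algebra_simps)

lemma T_sum: "(\<And>i. i \<in> A \<Longrightarrow> f i \<in> S) \<Longrightarrow> T (sum f A) = (\<Sum>i\<in>A. T (f i))"
  by (induction A rule: infinite_finite_induct)
    (auto simp: T_add subspace_sum[OF subspace_S])

lemma funpow_in: "x \<in> S \<Longrightarrow> (T ^^ i) x \<in> S"
  by (induction i) (auto intro: T_in)

lemma poly_op_bound:
  assumes "degree p \<le> N"
  shows "poly_op p x = (\<Sum>i\<le>N. scale (coeff p i) ((T ^^ i) x))"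
  unfolding poly_op_def
  by (rule sum.mono_neutral_left) (use assms in \<open>auto simp: coeff_eq_0\<close>)

lemma poly_op_0 [simp]: "poly_op 0 x = 0"
  by (simp add: poly_op_def)

lemma poly_op_1 [simp]: "poly_op 1 x = x"
  by (simp add: poly_op_def)

lemma poly_op_add: "poly_op (p + q) x = poly_op p x + poly_op q x"
proof -
  let ?N = "max (degree p) (degree q)"
  have "degree (p + q) \<le> ?N" by (rule degree_add_le_max)
  then show ?thesis
    by (simp add: poly_op_bound[of _ ?N] scale_left_distrib sum.distrib)
qed

lemma poly_op_smult: "poly_op (smult c p) x = scale c (poly_op p x)"
  using poly_op_bound[of "smult c p" "degree p" x]
  by (simp add: poly_op_def degree_smult_le scale_sum_right)

lemma poly_op_diff: "poly_op (p - q) x = poly_op p x - poly_op q x"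
  using poly_op_add[of "p - q" q x] by (simp add: algebra_simps)

lemma poly_op_pCons:
  assumes x: "x \<in> S"
  shows "poly_op (pCons a p) x = scale a x + T (poly_op p x)"
proof -
  have "poly_op (pCons a p) x = (\<Sum>i\<le>Suc (degree p). scale (coeff (pCons a p) i) ((T ^^ i) x))"
    by (rule poly_op_bound) (rule degree_pCons_le)
  also have "\<dots> = scale a x + (\<Sum>i\<le>degree p. scale (coeff p i) (T ((T ^^ i) x)))"
    by (subst sum.atMost_Suc_shift) simp
  also have "(\<Sum>i\<le>degree p. scale (coeff p i) (T ((T ^^ i) x))) = T (poly_op p x)"
    unfolding poly_op_def using x
    by (subst T_sum) (auto simp: T_scale funpow_in intro: subspace_scale[OF subspace_S])
  finally show ?thesis .
qed

lemma poly_op_in_invariant: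
  assumes "subspace M" "M \<subseteq> S" "\<And>y. y \<in> M \<Longrightarrow> T y \<in> M" "x \<in> M"
  shows "poly_op p x \<in> M"
proof (induction p)
  case 0
  then show ?case using assms(1) by (simp add: subspace_0)
next
  case (pCons a p)
  then show ?case
    using assms by (auto simp: poly_op_pCons subspace_add subspace_scale)
qed

lemma poly_op_in: "x \<in> S \<Longrightarrow> poly_op p x \<in> S"
  by (rule poly_op_in_invariant) (auto intro: T_in subspace_S)

lemma poly_op_mult:
  assumes x: "x \<in> S"
  shows "poly_op (p * q) x = poly_op p (poly_op q x)"
proof (induction p)
  case (pCons a p)
  then show ?case
    using x by (simp add: poly_op_add poly_op_smult poly_op_pCons poly_op_in)
qed simp

end

locale complex_subspace_endomorphism = subspace_endomorphism scale S T
  for scale :: "complex \<Rightarrow> 'a::ab_group_add \<Rightarrow> 'a" and S T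
begin

text \<open>
  Some \<open>p \<noteq> 0\<close> has \<open>p(T) v\<close> in \<open>M\<close>.  Splitting off a root of \<open>p\<close> and cancelling the corresponding
  factor lowers the degree until \<open>p\<close> is a nonzero constant, and then \<open>v\<close> itself is in \<open>M\<close>.
\<close>

lemma invariant_subspace_eq_cyclic:
  assumes v: "v \<in> S" and cyclic: "\<And>x. x \<in> S \<Longrightarrow> \<exists>p. x = poly_op p v"
    and M: "subspace M" "M \<subseteq> S" "\<And>y. y \<in> M \<Longrightarrow> T y \<in> M" "M \<noteq> {0}"
    and cancel: "\<And>c r. poly_op ([:- c, 1:] * r) v \<in> M \<Longrightarrow> poly_op r v \<in> M"
  shows "M = S"
proof -
  have "v \<in> M" if "p \<noteq> 0" "poly_op p v \<in> M" for p
    using that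
  proof (induction "degree p" arbitrary: p)
    case 0
    then obtain a where p: "p = [:a:]" using degree_eq_zeroE[of p] by auto
    then have "a \<noteq> 0" using 0 by auto
    have "scale a v \<in> M" using 0 v p by (simp add: poly_op_pCons)
    then have "scale (inverse a) (scale a v) \<in> M" by (rule subspace_scale[OF M(1)])
    then show ?case using \<open>a \<noteq> 0\<close> by simp
  next
    case (Suc n)
    then have "\<not> constant (poly p)" by (simp add: constant_degree)
    then obtain c where "poly p c = 0" using fundamental_theorem_of_algebra by blast
    then have "[:- c, 1:] dvd p" by (simp only: poly_eq_0_iff_dvd)
    then obtain r where r: "p = [:- c, 1:] * r" by (rule dvdE)
    have r0: "r \<noteq> 0" using Suc.prems(1) unfolding r by (rule contrapos_nn) (simp only: mult_zero_right)
    then have "degree p = Suc (degree r)" unfolding r by (subst degree_mult_eq) auto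
    then have "n = degree r" using Suc.hyps(2) by simp
    moreover have "poly_op r v \<in> M" using Suc.prems(2) unfolding r by (rule cancel)
    ultimately show ?case using Suc.hyps(1)[of r] r0 by blast
  qed
  moreover obtain x where x: "x \<in> M" "x \<noteq> 0" using M(4) subspace_0[OF M(1)] by blast
  moreover obtain p where p: "x = poly_op p v" using cyclic[of x] M(2) x(1) by blast
  moreover have "p \<noteq> 0" using x(2) p by auto
  ultimately have "v \<in> M" by blast
  then have "poly_op p v \<in> M" for p using poly_op_in_invariant[OF M(1-3)] by blast
  then show "M = S" using cyclic M(2) by blast
qed

end

section \<open>The space of polynomials with sparsely large weights\<close>

definition fin_supp :: "(nat \<Rightarrow> complex) set" where
  "fin_supp = {f. finite {n. f n \<noteq> 0}}"

definition cscale :: "complex \<Rightarrow> (nat \<Rightarrow> complex) \<Rightarrow> nat \<Rightarrow> complex" where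
  "cscale c f = (\<lambda>n. c * f n)"

text \<open>
  For instance, every nonnegative weight supported on a set with a finite sum of reciprocals
  qualifies.  The cut-off at 1 leaves its size on such a set unrestricted, and
  \<open>t \<mapsto> min 1 t\<close> is subadditive, so sums of weights are weights.
\<close>

definition weights :: "(nat \<Rightarrow> real) set" where
  "weights = {w. (\<forall>n. 0 \<le> w n) \<and> summable (\<lambda>n. min 1 (w n) / real (Suc n))}"

definition wnorm :: "(nat \<Rightarrow> real) \<Rightarrow> (nat \<Rightarrow> complex) \<Rightarrow> real" where
  "wnorm w f = (\<Sum>n. w n * cmod (f n))"

definition mono_vec :: "nat \<Rightarrow> nat \<Rightarrow> complex" where
  "mono_vec n = (\<lambda>k. if k = n then 1 else 0)"

text \<open>
  Integration from 1 to \<open>x\<close> on coefficient sequences; the constant term makes the antiderivative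
  vanish at 1.  The infinite sum is a finite one on \<^term>\<open>fin_supp\<close>.
\<close>

definition integ :: "(nat \<Rightarrow> complex) \<Rightarrow> nat \<Rightarrow> complex" where
  "integ f = (\<lambda>n. case n of 0 \<Rightarrow> - (\<Sum>k. f k / of_nat (Suc k)) | Suc m \<Rightarrow> f m / of_nat (Suc m))"

lemma cscale_apply: "cscale c f n = c * f n"
  by (simp add: cscale_def)

interpretation seq: vector_space cscale
  by unfold_locales (auto simp: fun_eq_iff cscale_apply algebra_simps)

lemma subspace_fin_supp: "seq.subspace fin_supp"
  unfolding seq.subspace_def fin_supp_def
proof (intro conjI ballI allI)
  fix x y :: "nat \<Rightarrow> complex" assume "x \<in> {f. finite {n. f n \<noteq> 0}}" "y \<in> {f. finite {n. f n \<noteq> 0}}"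
  then have "finite ({n. x n \<noteq> 0} \<union> {n. y n \<noteq> 0})" by simp
  moreover have "{n. (x + y) n \<noteq> 0} \<subseteq> {n. x n \<noteq> 0} \<union> {n. y n \<noteq> 0}" by auto
  ultimately show "x + y \<in> {f. finite {n. f n \<noteq> 0}}"
    using finite_subset by blast
qed (auto simp: cscale_apply elim!: rev_finite_subset)

lemma summable_fin_supp:
  fixes g :: "nat \<Rightarrow> 'a::real_normed_vector"
  assumes "f \<in> fin_supp" "\<And>n. f n = 0 \<Longrightarrow> g n = 0"
  shows "summable g"
  by (rule summable_finite[of "{n. f n \<noteq> 0}"]) (use assms in \<open>auto simp: fin_supp_def\<close>)

lemma summable_wnorm: "f \<in> fin_supp \<Longrightarrow> summable (\<lambda>n. w n * cmod (f n))"
  by (rule summable_fin_supp) auto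

lemma mono_vec_in: "mono_vec n \<in> fin_supp"
  by (simp add: fin_supp_def mono_vec_def)

lemma wnorm_mono_vec: "wnorm w (mono_vec n) = w n"
proof -
  have "(\<Sum>k. w k * cmod (mono_vec n k)) = (\<Sum>k\<in>{n}. w k * cmod (mono_vec n k))"
    by (rule suminf_finite) (auto simp: mono_vec_def)
  then show ?thesis by (simp add: wnorm_def mono_vec_def)
qed

lemma partial_sum_le_wnorm:
  assumes "w \<in> weights" "f \<in> fin_supp" "finite A"
  shows "(\<Sum>n\<in>A. w n * cmod (f n)) \<le> wnorm w f"
  unfolding wnorm_def
  by (rule sum_le_suminf) (use assms summable_wnorm in \<open>auto simp: weights_def\<close>)

lemma wnorm_le:
  assumes "f \<in> fin_supp" "\<And>N. (\<Sum>n<N. w n * cmod (f n)) \<le> b"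
  shows "wnorm w f \<le> b"
  unfolding wnorm_def by (rule suminf_le_const) (use assms summable_wnorm in auto)

lemma weights_nonneg: "w \<in> weights \<Longrightarrow> 0 \<le> w n"
  by (simp add: weights_def)

lemma weights_add:
  assumes "v \<in> weights" "w \<in> weights"
  shows "(\<lambda>n. v n + w n) \<in> weights"
proof -
  have "summable (\<lambda>n. min 1 (v n + w n) / real (Suc n))"
  proof (rule summable_comparison_test_ev)
    show "summable (\<lambda>n. min 1 (v n) / real (Suc n) + min 1 (w n) / real (Suc n))"
      using assms by (intro summable_add) (auto simp: weights_def)
    have "norm (min 1 (v n + w n) / real (Suc n)) \<le> min 1 (v n) / real (Suc n) + min 1 (w n) / real (Suc n)" for n
      using weights_nonneg[OF assms(1), of n] weights_nonneg[OF assms(2), of n]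
      unfolding add_divide_distrib[symmetric] by (auto simp: divide_simps min_def)
    then show "\<forall>\<^sub>F n in sequentially. norm (min 1 (v n + w n) / real (Suc n))
        \<le> min 1 (v n) / real (Suc n) + min 1 (w n) / real (Suc n)" by simp
  qed
  then show ?thesis using assms by (simp add: weights_def)
qed

lemma weights_scale:
  assumes w: "w \<in> weights" and c: "c \<ge> 0"
  shows "(\<lambda>n. c * w n) \<in> weights"
proof -
  have "summable (\<lambda>n. min 1 (c * w n) / real (Suc n))"
  proof (rule summable_comparison_test_ev)
    show "summable (\<lambda>n. max 1 c * (min 1 (w n) / real (Suc n)))"
      using w by (intro summable_mult) (simp add: weights_def)
    have "norm (min 1 (c * w n) / real (Suc n)) \<le> max 1 c * (min 1 (w n) / real (Suc n))" for n
    proof -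
      have "min 1 (c * w n) \<le> max 1 c * min 1 (w n)"
      proof (cases "w n \<le> 1")
        case True
        then show ?thesis using mult_right_mono[of c "max 1 c" "w n"] weights_nonneg[OF w, of n]
          by (simp add: min.coboundedI2)
      qed simp
      then show ?thesis
        using divide_right_mono[of "min 1 (c * w n)" "max 1 c * min 1 (w n)" "real (Suc n)"]
          weights_nonneg[OF w, of n] c by simp
    qed
    then show "\<forall>\<^sub>F n in sequentially. norm (min 1 (c * w n) / real (Suc n))
        \<le> max 1 c * (min 1 (w n) / real (Suc n))" by simp
  qed
  then show ?thesis using assms by (simp add: weights_def)
qed

text \<open>
  Along a sequence that grows at least like \<open>2^k\<close> the reciprocals are dominated by a geometric
  series, whatever the values of the weight there.
\<close>

lemma weights_sparse:
  assumes "strict_mono g" "\<And>k. g k \<ge> 2 ^ k" "\<And>n. w n \<ge> 0" "\<And>n. n \<notin> range g \<Longrightarrow> w n = 0"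
  shows "w \<in> weights"
proof -
  have "summable (\<lambda>k. min 1 (w (g k)) / real (Suc (g k)))"
  proof (rule summable_comparison_test_ev)
    show "summable (\<lambda>k. (1/2) ^ k :: real)" by (rule summable_geometric) simp
    have "norm (min 1 (w (g k)) / real (Suc (g k))) \<le> (1/2) ^ k" for k
    proof -
      have "norm (min 1 (w (g k)) / real (Suc (g k))) \<le> 1 / real (Suc (g k))"
        using assms(3)[of "g k"] by (auto simp: divide_simps)
      also have "\<dots> \<le> 1 / 2 ^ k"
      proof (rule divide_left_mono)
        have "real (2 ^ k) \<le> real (Suc (g k))" using assms(2)[of k] by (intro of_nat_mono) simp
        then show "2 ^ k \<le> real (Suc (g k))" by simp
      qed (auto simp del: of_nat_Suc)
      finally show ?thesis by (simp add: power_divide)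
    qed
    then show "\<forall>\<^sub>F k in sequentially. norm (min 1 (w (g k)) / real (Suc (g k))) \<le> (1/2) ^ k" by simp
  qed
  then have "summable (\<lambda>n. min 1 (w n) / real (Suc n))"
    using summable_mono_reindex[OF assms(1), of "\<lambda>n. min 1 (w n) / real (Suc n)"] assms(4) by simp
  then show ?thesis using assms(3) by (simp add: weights_def)
qed

text \<open>
  This richness of the family of weights is what makes the space complete.
\<close>

lemma weights_large_on_infinite:
  assumes "infinite A" "\<And>n. n \<in> A \<Longrightarrow> c n > 0"
  obtains w where "w \<in> weights" "infinite {n \<in> A. w n = c n}"
proof -
  define g where "g k = enumerate A (2 ^ k)" for k
  have g: "strict_mono g"
    unfolding g_def strict_mono_def by (simp add: enumerate_mono assms(1))
  have gA: "range g \<subseteq> A" using enumerate_in_set[OF assms(1)] by (auto simp: g_def)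
  define w where "w n = (if n \<in> range g then c n else 0)" for n
  have "w \<in> weights"
  proof (rule weights_sparse[OF g])
    show "g k \<ge> 2 ^ k" for k unfolding g_def by (rule le_enumerate[OF assms(1)])
    show "w n \<ge> 0" for n using assms(2)[of n] gA by (auto simp: w_def less_imp_le)
  qed (auto simp: w_def)
  moreover have "range g \<subseteq> {n \<in> A. w n = c n}" using gA by (auto simp: w_def)
  then have "infinite {n \<in> A. w n = c n}"
    using range_inj_infinite[OF strict_mono_imp_inj_on[OF g]] infinite_super by blast
  ultimately show thesis using that by blast
qed

lemma weights_single: "(\<lambda>k. if k = n then 1 else 0) \<in> weights"
proof -
  have "summable (\<lambda>k. min 1 (if k = n then 1 else 0) / real (Suc k))"
    by (rule summable_finite[of "{n}"]) auto
  then show ?thesis by (simp add: weights_def)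
qed

text \<open>
  This is the weight that bounds integration.  The multiple \<open>w 0 / (n+1)\<close> of the constant term
  contributes \<open>w 0 / (n+1)^2\<close> to the series, and shifting the index costs a factor of at most 2.
\<close>

lemma weights_integ:
  assumes w: "w \<in> weights"
  shows "(\<lambda>n. (w 0 + w (Suc n)) / real (Suc n)) \<in> weights"
proof -
  have w0: "w n \<ge> 0" for n using w by (rule weights_nonneg)
  have "summable (\<lambda>n. min 1 ((w 0 + w (Suc n)) / real (Suc n)) / real (Suc n))"
  proof (rule summable_comparison_test_ev)
    have "summable (\<lambda>n. w 0 * (1 / real (Suc n) ^ 2))"
      using inverse_power_summable[of 2, where 'a = real, THEN summable_ignore_initial_segment, of 1]
      by (intro summable_mult) (simp add: inverse_eq_divide)
    moreover have "summable (\<lambda>n. 2 * (min 1 (w (Suc n)) / real (Suc (Suc n))))"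
      using w summable_Suc_iff[of "\<lambda>n. min 1 (w n) / real (Suc n)"]
      by (intro summable_mult) (simp add: weights_def)
    ultimately show "summable (\<lambda>n. w 0 * (1 / real (Suc n) ^ 2) + 2 * (min 1 (w (Suc n)) / real (Suc (Suc n))))"
      by (rule summable_add)
    have "norm (min 1 ((w 0 + w (Suc n)) / real (Suc n)) / real (Suc n))
        \<le> w 0 * (1 / real (Suc n) ^ 2) + 2 * (min 1 (w (Suc n)) / real (Suc (Suc n)))" for n
    proof -
      define N where "N = real (Suc n)"
      have N: "N \<ge> 1" "real (Suc (Suc n)) = N + 1" by (auto simp: N_def)
      have "w 0 / N \<ge> 0" using w0[of 0] N by simp
      then have "min 1 ((w 0 + w (Suc n)) / N) \<le> w 0 / N + min 1 (w (Suc n) / N)"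
        unfolding add_divide_distrib by linarith
      also have "min 1 (w (Suc n) / N) \<le> min 1 (w (Suc n))"
        using w0[of "Suc n"] N divide_left_mono[of 1 N "w (Suc n)"] by (simp add: min.coboundedI2)
      finally have "min 1 ((w 0 + w (Suc n)) / N) / N \<le> (w 0 / N + min 1 (w (Suc n))) / N"
        using N by (intro divide_right_mono) auto
      also have "\<dots> = w 0 * (1 / N ^ 2) + min 1 (w (Suc n)) / N"
        by (simp add: add_divide_distrib power2_eq_square)
      also have "min 1 (w (Suc n)) / N \<le> 2 * (min 1 (w (Suc n)) / (N + 1))"
      proof -
        have "1 / N \<le> 2 / (N + 1)" using N by (simp add: divide_simps)
        then show ?thesis
          using mult_left_mono[of "1 / N" "2 / (N + 1)" "min 1 (w (Suc n))"] w0[of "Suc n"]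
          by (simp add: ac_simps)
      qed
      finally show ?thesis using w0[of 0] w0[of "Suc n"] N by (simp add: N_def[symmetric] add.commute)
    qed
    then show "\<forall>\<^sub>F n in sequentially. norm (min 1 ((w 0 + w (Suc n)) / real (Suc n)) / real (Suc n))
        \<le> w 0 * (1 / real (Suc n) ^ 2) + 2 * (min 1 (w (Suc n)) / real (Suc (Suc n)))" by simp
  qed
  then show ?thesis using w0 by (simp add: weights_def)
qed

text \<open>
  A weight that is eventually at least \<open>e > 0\<close> would make a multiple of the harmonic series converge.
\<close>

lemma weights_frequently_small:
  assumes w: "w \<in> weights" and e: "e > 0"
  shows "\<exists>\<^sub>F n in sequentially. w n < e"
proof (rule ccontr)
  assume "\<not> ?thesis"
  then have large: "\<forall>\<^sub>F n in sequentially. e \<le> w n"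
    by (simp add: not_frequently not_less)
  define d where "d = min 1 e"
  have d: "d > 0" using e by (simp add: d_def)
  have "summable (\<lambda>n. d * (1 / real (Suc n)))"
  proof (rule summable_comparison_test_ev)
    show "summable (\<lambda>n. min 1 (w n) / real (Suc n))" using w by (simp add: weights_def)
    show "\<forall>\<^sub>F n in sequentially. norm (d * (1 / real (Suc n))) \<le> min 1 (w n) / real (Suc n)"
      using large by eventually_elim (use d in \<open>auto simp: d_def divide_simps\<close>)
  qed
  then have "summable (\<lambda>n. 1 / real (Suc n))"
    by (rule summable_mult_D) (use d in simp)
  then have "summable (\<lambda>n. 1 / real n)"
    by (subst (asm) summable_Suc_iff)
  then show False using not_summable_harmonic[where 'a = real] by (simp add: inverse_eq_divide)
qed

interpretation X: separating_seminorms cscale fin_supp weights wnorm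
proof unfold_locales
  show "seq.subspace fin_supp" by (rule subspace_fin_supp)
  show "weights \<noteq> {}" using weights_single by blast
  show "\<exists>k\<in>weights. \<forall>x\<in>fin_supp. wnorm v x \<le> wnorm k x \<and> wnorm w x \<le> wnorm k x"
    if "v \<in> weights" "w \<in> weights" for v w
  proof (intro bexI[of _ "\<lambda>n. v n + w n"] ballI conjI)
    show "(\<lambda>n. v n + w n) \<in> weights" using that by (rule weights_add)
    fix x assume "x \<in> fin_supp"
    then show "wnorm v x \<le> wnorm (\<lambda>n. v n + w n) x" "wnorm w x \<le> wnorm (\<lambda>n. v n + w n) x"
      unfolding wnorm_def using that
      by (auto intro!: suminf_le summable_wnorm mult_right_mono simp: weights_nonneg)
  qed
  show "wnorm w (x + y) \<le> wnorm w x + wnorm w y"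
    if w: "w \<in> weights" and x: "x \<in> fin_supp" and y: "y \<in> fin_supp" for w x y
  proof -
    have "wnorm w (x + y) \<le> (\<Sum>n. w n * cmod (x n) + w n * cmod (y n))"
      unfolding wnorm_def
    proof (rule suminf_le)
      show "summable (\<lambda>n. w n * cmod ((x + y) n))"
        by (rule summable_wnorm[OF seq.subspace_add[OF subspace_fin_supp x y]])
      show "w n * cmod ((x + y) n) \<le> w n * cmod (x n) + w n * cmod (y n)" for n
        using mult_left_mono[OF norm_triangle_ineq[of "x n" "y n"] weights_nonneg[OF w]]
        by (simp add: algebra_simps)
    qed (use x y in \<open>auto intro!: summable_wnorm summable_add\<close>)
    also have "\<dots> = wnorm w x + wnorm w y"
      unfolding wnorm_def by (rule suminf_add[symmetric]) (use x y summable_wnorm in auto)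
    finally show ?thesis .
  qed
  show "wnorm w (cscale c x) = cmod c * wnorm w x" if "x \<in> fin_supp" for w c x
    unfolding wnorm_def using suminf_mult[OF summable_wnorm[OF that], of "cmod c" w]
    by (simp add: cscale_apply norm_mult ac_simps)
  show "\<exists>w\<in>weights. wnorm w x > 0" if x: "x \<in> fin_supp" "x \<noteq> 0" for x
  proof -
    obtain n where n: "x n \<noteq> 0" using x(2) by (auto simp: fun_eq_iff)
    have "0 < cmod (x n)" using n by simp
    also have "\<dots> \<le> wnorm (\<lambda>k. if k = n then 1 else 0) x"
      using partial_sum_le_wnorm[OF weights_single x(1), of "{n}" n] by simp
    finally show ?thesis using weights_single by blast
  qed
qed

section \<open>Completeness and dimension\<close>

text \<open>
  Evaluating one coefficient is continuous, so a Cauchy filter has a coefficientwise limit \<open>l\<close>, and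
  the Cauchy estimates pass to this limit on finite sets of indices.  If \<open>l\<close> had infinite support, some
  weight would equal \<open>1 / \<bar>l n\<bar>\<close> at infinitely many \<open>n\<close>; a finitely supported \<open>x\<close> close to \<open>l\<close>
  in that seminorm would then be at distance at least 1 from it.
\<close>

lemma complete_X: "X.complete_tvs"
  unfolding X.complete_tvs_def
proof (intro allI impI)
  fix F :: "(nat \<Rightarrow> complex) filter"
  assume "F \<noteq> bot \<and> X.cauchy_filter_on F"
  then have nb: "F \<noteq> bot" and F: "X.cauchy_filter_on F" by auto
  have "\<exists>l. ((\<lambda>x. x n) \<longlongrightarrow> l) F" for n
  proof -
    have "cauchy_filter (filtermap (\<lambda>x. x n) F)"
      unfolding cauchy_filter_metric_filtermap
    proof (intro allI impI)
      fix e :: real assume "e > 0"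
      then obtain Q where Q: "eventually Q F" "\<And>x y. Q x \<Longrightarrow> Q y \<Longrightarrow>
          x \<in> fin_supp \<and> y \<in> fin_supp \<and> wnorm (\<lambda>k. if k = n then 1 else 0) (x - y) < e"
        using X.cauchy_filter_on_seminormD[OF F weights_single] by metis
      have "dist (x n) (y n) < e" if "Q x" "Q y" for x y
        using Q(2)[OF that] partial_sum_le_wnorm[OF weights_single, of "x - y" "{n}" n]
          seq.subspace_diff[OF subspace_fin_supp, of x y]
        by (simp add: dist_norm)
      then show "\<exists>P. eventually P F \<and> (\<forall>x y. P x \<and> P y \<longrightarrow> dist (x n) (y n) < e)"
        using Q(1) by blast
    qed
    moreover have "filtermap (\<lambda>x. x n) F \<noteq> bot" using nb by (simp add: filtermap_bot_iff)
    ultimately obtain l where "filtermap (\<lambda>x. x n) F \<le> nhds l"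
      using complete_UNIV[where 'a = complex] unfolding complete_uniform by auto
    then show ?thesis by (auto simp: filterlim_def)
  qed
  then obtain l where l: "\<And>n. ((\<lambda>x. x n) \<longlongrightarrow> l n) F" by metis
  have near: "\<exists>Q. eventually Q F \<and> (\<forall>x. Q x \<longrightarrow> x \<in> fin_supp \<and>
      (\<forall>A. finite A \<longrightarrow> (\<Sum>n\<in>A. w n * cmod (x n - l n)) \<le> e))"
    if w: "w \<in> weights" and e: "e > 0" for w e
  proof -
    obtain Q where Q: "eventually Q F" "\<And>x y. Q x \<Longrightarrow> Q y \<Longrightarrow>
          x \<in> fin_supp \<and> y \<in> fin_supp \<and> wnorm w (x - y) < e"
      using X.cauchy_filter_on_seminormD[OF F w e] by metis
    have "(\<Sum>n\<in>A. w n * cmod (x n - l n)) \<le> e" if x: "Q x" and A: "finite A" for x A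
    proof (rule tendsto_upperbound[OF _ _ nb])
      show "((\<lambda>y. \<Sum>n\<in>A. w n * cmod (x n - y n)) \<longlongrightarrow> (\<Sum>n\<in>A. w n * cmod (x n - l n))) F"
        by (intro tendsto_intros l)
      show "\<forall>\<^sub>F y in F. (\<Sum>n\<in>A. w n * cmod (x n - y n)) \<le> e"
        using Q(1)
      proof eventually_elim
        case (elim y)
        then show ?case
          using Q(2)[OF x elim] partial_sum_le_wnorm[OF w _ A, of "x - y"]
            seq.subspace_diff[OF subspace_fin_supp, of x y] by simp
      qed
    qed
    then show ?thesis using Q by blast
  qed
  have l_in: "l \<in> fin_supp"
  proof (rule ccontr)
    assume "l \<notin> fin_supp"
    then have inf: "infinite {n. l n \<noteq> 0}" by (simp add: fin_supp_def)
    obtain w where w: "w \<in> weights" "infinite {n \<in> {n. l n \<noteq> 0}. w n = 1 / cmod (l n)}"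
      using weights_large_on_infinite[OF inf, of "\<lambda>n. 1 / cmod (l n)"] by auto
    obtain Q where Q: "eventually Q F" "\<And>x A. Q x \<Longrightarrow> finite A \<Longrightarrow>
        x \<in> fin_supp \<and> (\<Sum>n\<in>A. w n * cmod (x n - l n)) \<le> 1/2"
      using near[OF w(1), of "1/2"] by auto
    obtain x where x: "Q x" using Q(1) nb eventually_happens by blast
    then have "finite {n. x n \<noteq> 0}" using Q(2)[of x "{}"] by (simp add: fin_supp_def)
    then have "infinite ({n \<in> {n. l n \<noteq> 0}. w n = 1 / cmod (l n)} - {n. x n \<noteq> 0})"
      using w(2) by (rule Diff_infinite_finite)
    then obtain n where "l n \<noteq> 0" "w n = 1 / cmod (l n)" "x n = 0"
      using infinite_imp_nonempty by blast
    then show False using Q(2)[OF x, of "{n}"] by simp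
  qed
  have "limitin X.seminorm_topology (\<lambda>x. x) l F"
  proof (rule X.limitin_seminormI[OF l_in])
    show "\<forall>\<^sub>F x in F. x \<in> fin_supp" using F by (simp add: X.cauchy_filter_on_def)
    fix w and e :: real assume we: "w \<in> weights" "e > 0"
    obtain Q where Q: "eventually Q F" "\<And>x A. Q x \<Longrightarrow> finite A \<Longrightarrow>
        x \<in> fin_supp \<and> (\<Sum>n\<in>A. w n * cmod (x n - l n)) \<le> e/2"
      using near[OF we(1), of "e/2"] we by auto
    show "\<forall>\<^sub>F x in F. wnorm w (x - l) < e"
      using Q(1)
    proof eventually_elim
      case (elim x)
      have "wnorm w (x - l) \<le> e/2"
        by (rule wnorm_le) (use Q(2)[OF elim] l_in in \<open>auto intro!: seq.subspace_diff[OF subspace_fin_supp]\<close>)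
      then show ?case using we by simp
    qed
  qed
  then show "\<exists>l. limitin X.seminorm_topology (\<lambda>x. x) l F" by blast
qed

lemma fin_supp_subset_subspace:
  assumes V: "seq.subspace V" "\<And>n. mono_vec n \<in> V"
  shows "fin_supp \<subseteq> V"
proof
  fix f assume "f \<in> fin_supp"
  then have "finite {n. f n \<noteq> 0}" by (simp add: fin_supp_def)
  moreover have "f \<in> V" if "finite A" "{n. f n \<noteq> 0} \<subseteq> A" for A f
    using that
  proof (induction A arbitrary: f)
    case empty
    then have "f = 0" by (auto simp: fun_eq_iff)
    then show ?case using V(1) seq.subspace_0 by blast
  next
    case (insert a A)
    have "f(a := 0) \<in> V" using insert.prems by (intro insert.IH) auto
    moreover have "f = f(a := 0) + cscale (f a) (mono_vec a)"
      by (auto simp: fun_eq_iff cscale_apply mono_vec_def)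
    ultimately show ?case
      using seq.subspace_add[OF V(1)] seq.subspace_scale[OF V(1) V(2)] by metis
  qed
  ultimately show "f \<in> V" by blast
qed

lemma countable_dim_X: "X.countable_algebraic_dim"
  unfolding X.countable_algebraic_dim_def
proof (intro exI conjI)
  have inj: "inj mono_vec"
    by (rule injI) (metis mono_vec_def zero_neq_one)
  show "seq.independent (range mono_vec)"
    unfolding seq.dependent_def
  proof clarify
    fix n assume n: "mono_vec n \<in> seq.span (range mono_vec - {mono_vec n})"
    have "seq.span (range mono_vec - {mono_vec n}) \<subseteq> {f. f n = 0}"
    proof (rule seq.span_minimal)
      show "range mono_vec - {mono_vec n} \<subseteq> {f. f n = 0}"
        by (auto simp: mono_vec_def)
      show "seq.subspace {f. f n = 0}" by (auto simp: seq.subspace_def cscale_apply)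
    qed
    then show False using n by (auto simp: mono_vec_def)
  qed
  have "seq.span (range mono_vec) = fin_supp"
  proof
    show "seq.span (range mono_vec) \<subseteq> fin_supp"
      by (rule seq.span_minimal) (auto simp: mono_vec_in subspace_fin_supp)
    show "fin_supp \<subseteq> seq.span (range mono_vec)"
      by (rule fin_supp_subset_subspace) (auto intro: seq.span_base)
  qed
  then show "seq.span (range mono_vec) = topspace X.seminorm_topology" by simp
  show "range mono_vec \<approx> (UNIV :: nat set)"
    using inj by (rule inj_on_image_eqpoll_self)
qed

section \<open>Integration and its lack of invariant subspaces\<close>

lemma integ_0: "integ f 0 = - (\<Sum>k. f k / of_nat (Suc k))"
  by (simp add: integ_def)

lemma integ_Suc [simp]: "integ f (Suc n) = f n / of_nat (Suc n)"
  by (simp add: integ_def)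

lemma summable_integ: "f \<in> fin_supp \<Longrightarrow> summable (\<lambda>k. f k / of_nat (Suc k))"
  by (rule summable_fin_supp) auto

lemma integ_in:
  assumes "f \<in> fin_supp"
  shows "integ f \<in> fin_supp"
proof -
  have "{n. integ f n \<noteq> 0} \<subseteq> insert 0 (Suc ` {n. f n \<noteq> 0})"
  proof
    fix n assume "n \<in> {n. integ f n \<noteq> 0}"
    then show "n \<in> insert 0 (Suc ` {n. f n \<noteq> 0})" by (cases n) auto
  qed
  then show ?thesis using assms by (auto simp: fin_supp_def intro: finite_subset)
qed

interpretation integ: complex_subspace_endomorphism cscale fin_supp integ
proof unfold_locales
  show "seq.subspace fin_supp" by (rule subspace_fin_supp)
  show "integ f \<in> fin_supp" if "f \<in> fin_supp" for f using that by (rule integ_in)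
  show "integ (f + g) = integ f + integ g" if f: "f \<in> fin_supp" and g: "g \<in> fin_supp" for f g
  proof
    fix n show "integ (f + g) n = (integ f + integ g) n"
      by (cases n)
        (simp_all add: integ_0 add_divide_distrib del: of_nat_Suc
          flip: suminf_add[OF summable_integ[OF f] summable_integ[OF g]])
  qed
  show "integ (cscale c f) = cscale c (integ f)" if f: "f \<in> fin_supp" for c f
  proof
    fix n show "integ (cscale c f) n = cscale c (integ f) n"
      using suminf_mult[OF summable_integ[OF f], of c]
      by (cases n) (simp_all add: integ_0 cscale_apply)
  qed
qed

lemma wnorm_integ_le:
  assumes w: "w \<in> weights" and f: "f \<in> fin_supp"
  shows "wnorm w (integ f) \<le> wnorm (\<lambda>n. (w 0 + w (Suc n)) / real (Suc n)) f"
proof -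
  have s0: "summable (\<lambda>k. cmod (f k / of_nat (Suc k)))"
    by (rule summable_fin_supp[OF f]) auto
  have s1: "summable (\<lambda>k. w (Suc k) * cmod (f k / of_nat (Suc k)))"
    by (rule summable_fin_supp[OF f]) auto
  have "wnorm w (integ f) = w 0 * cmod (integ f 0) + (\<Sum>k. w (Suc k) * cmod (f k / of_nat (Suc k)))"
    using suminf_split_head[OF summable_wnorm[OF integ_in[OF f], of w]]
    by (simp add: wnorm_def)
  also have "w 0 * cmod (integ f 0) \<le> w 0 * (\<Sum>k. cmod (f k / of_nat (Suc k)))"
    unfolding integ_0 norm_minus_cancel
    by (rule mult_left_mono[OF summable_norm[OF s0] weights_nonneg[OF w]])
  also have "\<dots> = (\<Sum>k. w 0 * cmod (f k / of_nat (Suc k)))"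
    by (rule suminf_mult[OF s0, symmetric])
  also have "\<dots> + (\<Sum>k. w (Suc k) * cmod (f k / of_nat (Suc k))) =
      (\<Sum>k. w 0 * cmod (f k / of_nat (Suc k)) + w (Suc k) * cmod (f k / of_nat (Suc k)))"
    by (rule suminf_add[OF summable_mult[OF s0] s1])
  also have "\<dots> = wnorm (\<lambda>n. (w 0 + w (Suc n)) / real (Suc n)) f"
    unfolding wnorm_def by (simp add: norm_divide add_divide_distrib algebra_simps del: of_nat_Suc)
  finally show ?thesis by simp
qed

lemma integ_bounded: "w \<in> weights \<Longrightarrow> \<exists>v\<in>weights. \<forall>f\<in>fin_supp. wnorm w (integ f) \<le> wnorm v f"
  using wnorm_integ_le weights_integ by blast

lemma continuous_integ: "X.continuous_linear_operator integ"
  unfolding X.continuous_linear_operator_def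
  using X.continuous_map_seminormI[OF integ.T_in integ.T_diff integ_bounded] integ.T_add integ.T_scale
  by simp

text \<open>
  Polynomials in the operator are continuous.  Only their values on monomials are estimated, because
  the seminorm of the monomial of degree \<open>n\<close> is the \<open>n\<close>-th entry of the weight.
\<close>

lemma poly_op_integ_mono_vec_bounded:
  assumes "w \<in> weights"
  shows "\<exists>v\<in>weights. \<forall>n. wnorm w (integ.poly_op p (mono_vec n)) \<le> v n"
  using assms
proof (induction p arbitrary: w)
  case 0
  then show ?case by (intro bexI[of _ w]) (simp_all add: wnorm_def weights_nonneg)
next
  case (pCons a p)
  obtain w' where w': "w' \<in> weights" "\<And>f. f \<in> fin_supp \<Longrightarrow> wnorm w (integ f) \<le> wnorm w' f"
    using integ_bounded[OF pCons.prems] by blast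
  obtain v where v: "v \<in> weights" "\<And>n. wnorm w' (integ.poly_op p (mono_vec n)) \<le> v n"
    using pCons.IH[OF w'(1)] by blast
  have "wnorm w (integ.poly_op (pCons a p) (mono_vec n)) \<le> cmod a * w n + v n" for n
  proof -
    have "integ.poly_op p (mono_vec n) \<in> fin_supp" by (simp add: integ.poly_op_in mono_vec_in)
    then have "wnorm w (integ.poly_op (pCons a p) (mono_vec n)) \<le>
        wnorm w (cscale a (mono_vec n)) + wnorm w' (integ.poly_op p (mono_vec n))"
      using X.P_add[OF pCons.prems, of "cscale a (mono_vec n)" "integ (integ.poly_op p (mono_vec n))"]
        w'(2)[of "integ.poly_op p (mono_vec n)"] integ_in seq.subspace_scale[OF subspace_fin_supp mono_vec_in]
      by (simp add: integ.poly_op_pCons mono_vec_in)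
    then show ?thesis
      using v(2)[of n] X.P_scale[OF pCons.prems mono_vec_in] by (simp add: wnorm_mono_vec)
  qed
  then show ?case
    using weights_add[OF weights_scale[OF pCons.prems, of "cmod a"] v(1)]
    by (intro bexI[of _ "\<lambda>n. cmod a * w n + v n"]) auto
qed

text \<open>
  The polynomial \<open>E n\<close> with \<open>E n (T) 1 = x^n\<close>.  Its value at \<open>c\<close> is the number that any
  linear functional \<open>\<phi>\<close> with \<open>\<phi> (T f) = c * \<phi> f\<close> and \<open>\<phi> 1 = 1\<close> takes at \<open>x^n\<close>.
\<close>

primrec mono_poly :: "nat \<Rightarrow> complex poly" where
  "mono_poly 0 = 1"
| "mono_poly (Suc n) = 1 + smult (of_nat (Suc n)) (pCons 0 (mono_poly n))"

lemma integ_mono_vec: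
  "integ (mono_vec n) = cscale (1 / of_nat (Suc n)) (mono_vec (Suc n) - mono_vec 0)"
proof
  fix k
  have "(\<Sum>j. mono_vec n j / of_nat (Suc j)) = (\<Sum>j\<in>{n}. mono_vec n j / of_nat (Suc j))"
    by (rule suminf_finite) (auto simp: mono_vec_def)
  then show "integ (mono_vec n) k = cscale (1 / of_nat (Suc n)) (mono_vec (Suc n) - mono_vec 0) k"
    by (cases k) (simp_all add: integ_0 cscale_apply, simp_all add: mono_vec_def)
qed

lemma poly_op_mono_poly: "integ.poly_op (mono_poly n) (mono_vec 0) = mono_vec n"
proof (induction n)
  case (Suc n)
  have "integ.poly_op (mono_poly (Suc n)) (mono_vec 0) =
      mono_vec 0 + cscale (of_nat (Suc n)) (integ (mono_vec n))"
    using Suc integ.T_scale[OF mono_vec_in]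
    by (simp add: integ.poly_op_add integ.poly_op_smult integ.poly_op_pCons mono_vec_in del: of_nat_Suc)
  also have "\<dots> = mono_vec (Suc n)"
    unfolding integ_mono_vec by (auto simp: fun_eq_iff cscale_apply simp del: of_nat_Suc)
  finally show ?case .
qed simp

lemma mono_vec_0_cyclic: "f \<in> fin_supp \<Longrightarrow> \<exists>p. f = integ.poly_op p (mono_vec 0)"
proof -
  have "fin_supp \<subseteq> range (\<lambda>p. integ.poly_op p (mono_vec 0))"
  proof (rule fin_supp_subset_subspace)
    show "seq.subspace (range (\<lambda>p. integ.poly_op p (mono_vec 0)))"
      unfolding seq.subspace_def
      by (auto simp: integ.poly_op_add[symmetric] integ.poly_op_smult[symmetric]
          intro: range_eqI[of _ _ 0])
    show "mono_vec n \<in> range (\<lambda>p. integ.poly_op p (mono_vec 0))" for n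
      using poly_op_mono_poly[of n] by (metis rangeI)
  qed
  then show "f \<in> fin_supp \<Longrightarrow> \<exists>p. f = integ.poly_op p (mono_vec 0)" by blast
qed

lemma poly_mono_poly:
  assumes "c \<noteq> 0"
  shows "poly (mono_poly n) c = fact n * c ^ n * (\<Sum>k\<le>n. (1 / c) ^ k / fact k)"
proof (induction n)
  case (Suc n)
  let ?s = "\<Sum>k\<le>n. (1 / c) ^ k / fact k"
  have "fact (Suc n) * c ^ Suc n * (\<Sum>k\<le>Suc n. (1 / c) ^ k / fact k) =
      fact (Suc n) * c ^ Suc n * ?s + fact (Suc n) * c ^ Suc n * ((1 / c) ^ Suc n / fact (Suc n))"
    by (simp only: sum.atMost_Suc distrib_left)
  also have "fact (Suc n) * c ^ Suc n * ((1 / c) ^ Suc n / fact (Suc n)) = 1"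
    using assms by (simp add: power_one_over del: fact_Suc power_Suc)
  also have "fact (Suc n) * c ^ Suc n * ?s = of_nat (Suc n) * c * poly (mono_poly n) c"
    unfolding Suc.IH by (simp add: mult_ac)
  finally show ?case by simp
qed simp

text \<open>
  For \<open>c = 0\<close> all values are 1.  For \<open>c \<noteq> 0\<close> the sum tends to \<open>exp (1/c) \<noteq> 0\<close>, while the factor
  \<open>n! * c^n\<close> has modulus at least 1 from some point on.
\<close>

lemma poly_mono_poly_bounded_below:
  "\<exists>d>0. \<forall>\<^sub>F n in sequentially. d \<le> cmod (poly (mono_poly n) c)"
proof (cases "c = 0")
  case True
  have "cmod (poly (mono_poly n) 0) = 1" for n by (cases n) auto
  then show ?thesis using True by (intro exI[of _ 1]) auto
next
  case False
  define E where "E = cmod (exp (1 / c))"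
  have E: "E > 0" by (simp add: E_def)
  have "(\<lambda>n. (1 / c) ^ n / fact n) sums exp (1 / c)"
    using exp_converges[of "1 / c"] by (simp add: scaleR_conv_of_real divide_inverse ac_simps)
  then have "(\<lambda>n. \<Sum>k\<le>n. (1 / c) ^ k / fact k) \<longlonglongrightarrow> exp (1 / c)"
    by (simp add: sums_def_le)
  then have "(\<lambda>n. cmod (\<Sum>k\<le>n. (1 / c) ^ k / fact k)) \<longlonglongrightarrow> E"
    unfolding E_def by (rule tendsto_norm)
  then have 1: "\<forall>\<^sub>F n in sequentially. E / 2 < cmod (\<Sum>k\<le>n. (1 / c) ^ k / fact k)"
    by (rule order_tendstoD) (use E in simp)
  have "(\<lambda>n. cmod (1 / c) ^ n / fact n) \<longlonglongrightarrow> 0"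
    using summable_exp[of "cmod (1 / c)"] by (auto dest: summable_LIMSEQ_zero simp: divide_inverse ac_simps)
  then have "\<forall>\<^sub>F n in sequentially. cmod (1 / c) ^ n / fact n < 1"
    by (rule order_tendstoD) simp
  then have "\<forall>\<^sub>F n in sequentially. E / 2 \<le> cmod (poly (mono_poly n) c)"
    using 1
  proof eventually_elim
    case (elim n)
    have "1 \<le> fact n * cmod c ^ n"
      using elim(1) False by (simp add: norm_divide power_one_over field_simps)
    then have "1 * (E / 2) \<le> (fact n * cmod c ^ n) * cmod (\<Sum>k\<le>n. (1 / c) ^ k / fact k)"
      using elim(2) E by (intro mult_mono) auto
    then show ?case by (simp add: poly_mono_poly[OF False] norm_mult norm_power)
  qed
  then show ?thesis using E by (intro exI[of _ "E / 2"]) simp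
qed

text \<open>
  With \<open>s = E n (c)\<close>, the polynomial \<open>E n - s\<close> is divisible by \<open>z - c\<close>, so \<open>M\<close> contains
  \<open>r(T) x^n - s * r(T) 1\<close>.  After division by \<open>- s\<close>, which is bounded away from 0 for large \<open>n\<close>, this differs from
  \<open>r(T) 1\<close> by a multiple of \<open>r(T) x^n\<close>; its seminorm is bounded by a weight at \<open>n\<close>, which is small for
  suitable \<open>n\<close>.  Closedness finishes the argument.
\<close>

lemma closed_invariant_cancel_linear_factor:
  assumes M: "X.closed_invariant_subspace integ M"
    and pM: "integ.poly_op ([:- c, 1:] * r) (mono_vec 0) \<in> M"
  shows "integ.poly_op r (mono_vec 0) \<in> M"
proof -
  let ?v = "mono_vec 0"
  have sub: "seq.subspace M" and closed: "closedin X.seminorm_topology M"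
    and inv: "\<And>y. y \<in> M \<Longrightarrow> integ y \<in> M"
    using M by (auto simp: X.closed_invariant_subspace_def)
  have MS: "M \<subseteq> fin_supp" using closedin_subset[OF closed] by simp
  obtain d where d: "d > 0" "\<forall>\<^sub>F n in sequentially. d \<le> cmod (poly (mono_poly n) c)"
    using poly_mono_poly_bounded_below by blast
  have diff_in: "integ.poly_op r (mono_vec n) - cscale (poly (mono_poly n) c) (integ.poly_op r ?v) \<in> M" for n
  proof -
    have "poly (mono_poly n - [:poly (mono_poly n) c:]) c = 0" by simp
    then obtain h where h: "mono_poly n - [:poly (mono_poly n) c:] = [:- c, 1:] * h"
      unfolding poly_eq_0_iff_dvd by (rule dvdE)
    have "integ.poly_op (h * ([:- c, 1:] * r)) ?v \<in> M"
      using integ.poly_op_in_invariant[OF sub MS inv pM] by (simp add: integ.poly_op_mult mono_vec_in)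
    also have "h * ([:- c, 1:] * r) = r * mono_poly n - smult (poly (mono_poly n) c) r"
      using arg_cong[OF h, of "\<lambda>p. r * p"] by (simp add: algebra_simps)
    finally show ?thesis
      by (simp only: integ.poly_op_diff integ.poly_op_smult integ.poly_op_mult[OF mono_vec_in]
          poly_op_mono_poly)
  qed
  show ?thesis
  proof (rule X.closedin_seminormD[OF closed])
    show "integ.poly_op r ?v \<in> fin_supp" by (simp add: integ.poly_op_in mono_vec_in)
    fix w and e :: real assume w: "w \<in> weights" and e: "e > 0"
    obtain u where u: "u \<in> weights" "\<And>n. wnorm w (integ.poly_op r (mono_vec n)) \<le> u n"
      using poly_op_integ_mono_vec_bounded[OF w] by blast
    have "\<exists>\<^sub>F n in sequentially. u n < d * e \<and> d \<le> cmod (poly (mono_poly n) c)"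
      using frequently_eventually_frequently[OF weights_frequently_small[OF u(1), of "d * e"] d(2)]
        d(1) e by simp
    then obtain n where n: "u n < d * e" "d \<le> cmod (poly (mono_poly n) c)"
      by (auto dest: frequently_ex)
    define s where "s = poly (mono_poly n) c"
    have s: "s \<noteq> 0" "d \<le> cmod s" using n d(1) by (auto simp: s_def)
    let ?x = "integ.poly_op r (mono_vec n)" and ?y = "integ.poly_op r ?v"
    have x: "?x \<in> fin_supp" by (simp add: integ.poly_op_in mono_vec_in)
    have "cscale (- 1 / s) (?x - cscale s ?y) \<in> M"
      unfolding s_def by (rule seq.subspace_scale[OF sub diff_in])
    moreover have "cscale (- 1 / s) (?x - cscale s ?y) - ?y = cscale (- 1 / s) ?x"
      using s by (auto simp: fun_eq_iff cscale_apply field_simps)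
    moreover have "wnorm w (cscale (- 1 / s) ?x) < e"
    proof -
      have "wnorm w (cscale (- 1 / s) ?x) = wnorm w ?x / cmod s"
        using X.P_scale[OF w x, of "- 1 / s"] by (simp add: norm_divide)
      also have "\<dots> \<le> wnorm w ?x / d"
        using s d(1) X.P_nonneg[OF w x] by (intro divide_left_mono) auto
      also have "\<dots> < e" using u(2)[of n] n(1) d(1) by (simp add: divide_simps mult.commute)
      finally show ?thesis .
    qed
    ultimately show "\<exists>m\<in>M. wnorm w (m - ?y) < e" by metis
  qed
qed

lemma integ_transitive:
  assumes M: "X.closed_invariant_subspace integ M" and "M \<noteq> {0}"
  shows "M = fin_supp"
proof (rule integ.invariant_subspace_eq_cyclic[OF mono_vec_in mono_vec_0_cyclic])
  show "seq.subspace M" "M \<subseteq> fin_supp" "\<And>y. y \<in> M \<Longrightarrow> integ y \<in> M"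
    using M closedin_subset[of X.seminorm_topology M] by (auto simp: X.closed_invariant_subspace_def)
qed (use assms closed_invariant_cancel_linear_factor in blast)+

theorem theorem1p3:
  "\<exists>(scale :: complex \<Rightarrow> (nat \<Rightarrow> complex) \<Rightarrow> (nat \<Rightarrow> complex)) (X :: (nat \<Rightarrow> complex) topology).
     complex_tvs scale X \<and>
     complex_tvs.locally_convex scale X \<and>
     complex_tvs.complete_tvs X \<and>
     complex_tvs.countable_algebraic_dim scale X \<and>
     \<not> complex_tvs.invariant_subspace_property scale X"
proof (intro exI conjI)
  show "complex_tvs cscale X.seminorm_topology" by unfold_locales
  show "X.locally_convex" by (rule X.locally_convex_seminorm)
  show "X.complete_tvs" by (rule complete_X)
  show "X.countable_algebraic_dim" by (rule countable_dim_X)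
  show "\<not> X.invariant_subspace_property"
    unfolding X.invariant_subspace_property_def
    using continuous_integ integ_transitive by auto
qed

end
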